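(* Let $\lambda_0\neq\lambda_1\in\mathbb C$ and let $\gamma:(-\epsilon,\epsilon)\to\mathbb C$ be a differentiable curve such that $\gamma(0)=\lambda_0$ and $\gamma'(0)=\lambda_1-\lambda_0\neq0$. Let $\Phi$ be an LWR frame, let $\Psi_t:=\Phi_{\gamma(t)}\Phi_{\gamma(0)}^{-1}$ and define $f_t^{\mathbb H}:=\Psi_t^*\Psi_t$. Then $$\frac{d}{dt}\big(f_t^{\mathbb H}\big)\Big|_{t=0}=f^{\mathbb E},$$ where $f^{\mathbb E}$ is the minimal immersion induced by the LWR frame $\Phi$ at the evaluation points $(\lambda_0,\lambda_1)$.
   Context: An LWR potential is a family $\xi_\lambda$ ($\lambda\in\mathbb C$) of $\mathrm{sl}_2\mathbb C$-valued 1-forms on a Riemann surface, locally $\xi_\lambda=(A\lambda+B)dz$ with $A,B$ holomorphic in $z$ and $A$ nilpotent. An LWR frame is a family $\Phi_\lambda$ of $\mathrm{SL}_2\mathbb C$-valued maps, holomorphic in $z$ and in $\lambda\in\mathbb C$, with $\Phi^{-1}d\Phi$ an LWR potential. Hyperbolic space $\mathbb H^3$ is the set of $2\times2$ Hermitian matrices with determinant $1$ and positive trace, and Euclidean space $\mathbb E^3=T_{\mathrm I}\mathbb H^3$ is the space of trace-free $2\times 2$ Hermitian matrices. The minimal immersion induced by $\Phi$ at $(\lambda_0,\lambda_1)$ is $f^{\mathbb E}=\psi+\psi^*$ with $\psi=(\lambda_1-\lambda_0)(\dot\Phi\Phi^{-1})|_{\lambda=\lambda_0}$, the dot denoting $\partial/\partial\lambda$.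 *)

theory Defs
  imports "HOL-Analysis.Analysis"
begin

type_synonym mat2 = "complex ^ 2 ^ 2"

definition mscale :: "complex \<Rightarrow> mat2 \<Rightarrow> mat2" (infixr "*\<^sub>M" 75) where
  "c *\<^sub>M X = map_matrix (\<lambda>x. c * x) X"

definition mstar :: "mat2 \<Rightarrow> mat2" where
  "mstar X = map_matrix cnj (transpose X)"

definition mderiv :: "(complex \<Rightarrow> mat2) \<Rightarrow> complex \<Rightarrow> mat2" where
  "mderiv F z = (\<chi> i j. deriv (\<lambda>w. F w $ i $ j) z)"

definition mholomorphic_on :: "(complex \<Rightarrow> mat2) \<Rightarrow> complex set \<Rightarrow> bool"
    (infixl "mholomorphic'_on" 50) where
  "F mholomorphic_on S \<longleftrightarrow> (\<forall>i j. (\<lambda>z. F z $ i $ j) holomorphic_on S)"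

(* Powers are iterated matrix products: "X ^ n" on this type would be the componentwise power. *)
definition mnilpotent :: "mat2 \<Rightarrow> bool" where
  "mnilpotent X \<longleftrightarrow> (\<exists>n. ((\<lambda>Y. X ** Y) ^^ n) (mat 1) = 0)"

definition SL2 :: "mat2 set" where
  "SL2 = {X. det X = 1}"

definition sl2 :: "mat2 set" where
  "sl2 = {X. trace X = 0}"


type_synonym 'a chart = "'a set \<times> ('a \<Rightarrow> complex)"

definition chart_inv :: "'a chart \<Rightarrow> complex \<Rightarrow> 'a" where
  "chart_inv c = inv_into (fst c) (snd c)"

definition chart_image :: "'a chart \<Rightarrow> complex set" where
  "chart_image c = snd c ` fst c"

definition transition :: "'a chart \<Rightarrow> 'a chart \<Rightarrow> complex \<Rightarrow> complex" where
  "transition c d = snd d \<circ> chart_inv c"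

definition is_chart :: "'a topology \<Rightarrow> 'a chart \<Rightarrow> bool" where
  "is_chart M c \<longleftrightarrow> openin M (fst c) \<and> open (chart_image c) \<and>
     homeomorphic_map (subtopology M (fst c)) (top_of_set (chart_image c)) (snd c)"

(* The atlas need not be maximal.  Second countability is automatic (Rado). *)
definition riemann_surface :: "'a topology \<Rightarrow> 'a chart set \<Rightarrow> bool" where
  "riemann_surface M \<A> \<longleftrightarrow>
     Hausdorff_space M \<and> connected_space M \<and>
     (\<forall>c\<in>\<A>. is_chart M c) \<and> (\<Union>c\<in>\<A>. fst c) = topspace M \<and>
     (\<forall>c\<in>\<A>. \<forall>d\<in>\<A>. transition c d holomorphic_on snd c ` (fst c \<inter> fst d))"

(* A matrix-valued 1-form of type (1,0) is represented by its coefficient functions: on the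
   domain of a chart c = (U, z) the form is "\<omega> c dz", and on overlaps the coefficients satisfy
   \<omega> c = (dw/dz) \<omega> d, where w is the coordinate of d. *)
type_synonym 'a mform = "'a chart \<Rightarrow> 'a \<Rightarrow> mat2"

definition sl2_form :: "'a chart set \<Rightarrow> 'a mform \<Rightarrow> bool" where
  "sl2_form \<A> \<omega> \<longleftrightarrow>
     (\<forall>c\<in>\<A>. \<forall>p\<in>fst c. \<omega> c p \<in> sl2) \<and>
     (\<forall>c\<in>\<A>. \<forall>d\<in>\<A>. \<forall>p\<in>fst c \<inter> fst d.
        \<omega> c p = deriv (transition c d) (snd c p) *\<^sub>M \<omega> d p)"

definition mholomorphic_on_surface :: "'a chart set \<Rightarrow> ('a \<Rightarrow> mat2) \<Rightarrow> bool" where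
  "mholomorphic_on_surface \<A> F \<longleftrightarrow>
     (\<forall>c\<in>\<A>. (\<lambda>z. F (chart_inv c z)) mholomorphic_on chart_image c)"

(* The form F^{-1} dF, for F holomorphic. *)
definition maurer_cartan :: "('a \<Rightarrow> mat2) \<Rightarrow> 'a mform" where
  "maurer_cartan F c p = matrix_inv (F p) ** mderiv (\<lambda>z. F (chart_inv c z)) (snd c p)"


(* A and B are determined by the form on each chart domain (put l = 0, 1), so asking for them on
   every chart of the atlas is the same as asking for them locally. *)
definition LWR_potential :: "'a chart set \<Rightarrow> (complex \<Rightarrow> 'a mform) \<Rightarrow> bool" where
  "LWR_potential \<A> \<xi> \<longleftrightarrow>
     (\<forall>l. sl2_form \<A> (\<xi> l)) \<and>
     (\<forall>c\<in>\<A>. \<exists>A B. A mholomorphic_on chart_image c \<and> B mholomorphic_on chart_image c \<and>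
        (\<forall>z\<in>chart_image c. mnilpotent (A z)) \<and>
        (\<forall>l. \<forall>p\<in>fst c. \<xi> l c p = l *\<^sub>M A (snd c p) + B (snd c p)))"

definition LWR_frame :: "'a topology \<Rightarrow> 'a chart set \<Rightarrow> (complex \<Rightarrow> 'a \<Rightarrow> mat2) \<Rightarrow> bool" where
  "LWR_frame M \<A> \<Phi> \<longleftrightarrow>
     (\<forall>l. \<forall>p\<in>topspace M. \<Phi> l p \<in> SL2) \<and>
     (\<forall>l. mholomorphic_on_surface \<A> (\<Phi> l)) \<and>
     (\<forall>p\<in>topspace M. (\<lambda>l. \<Phi> l p) mholomorphic_on UNIV) \<and>
     LWR_potential \<A> (\<lambda>l. maurer_cartan (\<Phi> l))"

definition minimal_psi :: "(complex \<Rightarrow> 'a \<Rightarrow> mat2) \<Rightarrow> complex \<Rightarrow> complex \<Rightarrow> 'a \<Rightarrow> mat2" where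
  "minimal_psi \<Phi> l0 l1 p =
     (l1 - l0) *\<^sub>M (mderiv (\<lambda>l. \<Phi> l p) l0 ** matrix_inv (\<Phi> l0 p))"

definition minimal_immersion :: "(complex \<Rightarrow> 'a \<Rightarrow> mat2) \<Rightarrow> complex \<Rightarrow> complex \<Rightarrow> 'a \<Rightarrow> mat2" where
  "minimal_immersion \<Phi> l0 l1 p = minimal_psi \<Phi> l0 l1 p + mstar (minimal_psi \<Phi> l0 l1 p)"

definition Psi :: "(complex \<Rightarrow> 'a \<Rightarrow> mat2) \<Rightarrow> (real \<Rightarrow> complex) \<Rightarrow> real \<Rightarrow> 'a \<Rightarrow> mat2" where
  "Psi \<Phi> \<gamma> t p = \<Phi> (\<gamma> t) p ** matrix_inv (\<Phi> (\<gamma> 0) p)"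

definition f_H :: "(complex \<Rightarrow> 'a \<Rightarrow> mat2) \<Rightarrow> (real \<Rightarrow> complex) \<Rightarrow> real \<Rightarrow> 'a \<Rightarrow> mat2" where
  "f_H \<Phi> \<gamma> t p = mstar (Psi \<Phi> \<gamma> t p) ** Psi \<Phi> \<gamma> t p"

end

theory Submission
  imports Defs
begin

text \<open>
  Only the parameter \<open>\<lambda>\<close> varies, so the claim is a computation with a curve of matrices at each
  fixed point \<open>p\<close> of the surface. Because \<open>\<Phi>\<close> is holomorphic in \<open>\<lambda>\<close>, the chain rule along
  \<open>\<gamma>\<close> gives that \<open>\<Psi>\<^sub>t = \<Phi>\<^bsub>\<gamma>(t)\<^esub> \<Phi>\<^bsub>\<gamma>(0)\<^esub>\<^sup>-\<^sup>1\<close> has derivative \<open>\<gamma>'(0)\<close> times the logarithmic derivative of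
  \<open>\<Phi>\<close> in \<open>\<lambda>\<close>, which is exactly \<open>\<psi>\<close>. Since \<open>\<Psi>\<^sub>0\<close> is the identity, the product rule
  for \<open>\<Psi>\<^sub>t\<^sup>* \<Psi>\<^sub>t\<close> leaves \<open>\<psi> + \<psi>\<^sup>*\<close>. The star is conjugate-linear over the complex numbers
  but linear over the reals, so it commutes with differentiation in the real parameter \<open>t\<close>.
\<close>

text \<open>
  A standard basis vector of a space of vectors is supported in a single component, so taking the
  inner product with it only sees that component; differentiability against every basis vector is
  therefore differentiability of every component.
\<close>

lemma has_vector_derivative_vec_iff:
  fixes F :: "real \<Rightarrow> 'a::euclidean_space ^ 'n"
  shows "(F has_vector_derivative D) (at t) \<longleftrightarrow>
    (\<forall>i. ((\<lambda>t. F t $ i) has_vector_derivative D $ i) (at t))"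
proof (intro iffI allI)
  fix i assume "(F has_vector_derivative D) (at t)"
  then show "((\<lambda>t. F t $ i) has_vector_derivative D $ i) (at t)"
    by (rule bounded_linear.has_vector_derivative[OF bounded_linear_vec_nth])
next
  assume "\<forall>i. ((\<lambda>t. F t $ i) has_vector_derivative D $ i) (at t)"
  then have "((\<lambda>t. F t $ i \<bullet> u) has_vector_derivative D $ i \<bullet> u) (at t)" for i u
    by (intro bounded_linear.has_vector_derivative[OF bounded_linear_inner_left]) blast
  then show "(F has_vector_derivative D) (at t)"
    unfolding has_vector_derivative_def has_derivative_componentwise_within[of F]
    by (auto simp: Basis_vec_def inner_axis)
qed

lemma has_vector_derivative_mat2_iff:
  fixes F :: "real \<Rightarrow> mat2"
  shows "(F has_vector_derivative D) (at t) \<longleftrightarrow>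
    (\<forall>i j. ((\<lambda>t. F t $ i $ j) has_vector_derivative D $ i $ j) (at t))"
  by (simp add: has_vector_derivative_vec_iff)

lemma has_vector_derivative_matrix_mult:
  fixes F G :: "real \<Rightarrow> mat2"
  assumes "(F has_vector_derivative F') (at t)" and "(G has_vector_derivative G') (at t)"
  shows "((\<lambda>t. F t ** G t) has_vector_derivative F t ** G' + F' ** G t) (at t)"
  using assms unfolding has_vector_derivative_mat2_iff matrix_matrix_mult_def
  by (auto simp flip: sum.distrib intro!: has_vector_derivative_sum has_vector_derivative_mult)

lemma has_vector_derivative_mstar:
  assumes "(F has_vector_derivative D) (at t)"
  shows "((\<lambda>t. mstar (F t)) has_vector_derivative mstar D) (at t)"
  using assms unfolding has_vector_derivative_mat2_iff
  by (auto simp: mstar_def map_matrix_def transpose_def intro!: has_vector_derivative_cnj)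

text \<open>
  Holomorphy is what lets the derivative along any curve be read off from the single complex
  derivative \<open>\<partial>F/\<partial>\<lambda>\<close>, with the velocity of the curve entering as a complex scalar factor.
\<close>

lemma has_vector_derivative_mholomorphic_compose:
  assumes "F mholomorphic_on S" and "open S" and "\<gamma> t \<in> S"
    and "(\<gamma> has_vector_derivative v) (at t)"
  shows "((\<lambda>t. F (\<gamma> t)) has_vector_derivative v *\<^sub>M mderiv F (\<gamma> t)) (at t)"
  unfolding has_vector_derivative_mat2_iff
proof (intro allI)
  fix i j :: 2
  have "((\<lambda>w. F w $ i $ j) has_field_derivative mderiv F (\<gamma> t) $ i $ j) (at (\<gamma> t))"
    using assms(1-3) by (auto simp: mholomorphic_on_def mderiv_def intro: holomorphic_derivI)
  from field_vector_diff_chain_at[OF assms(4) this]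
  show "((\<lambda>t. F (\<gamma> t) $ i $ j) has_vector_derivative (v *\<^sub>M mderiv F (\<gamma> t)) $ i $ j) (at t)"
    by (simp add: o_def mscale_def map_matrix_def)
qed

lemma mscale_matrix_mult: "(c *\<^sub>M X) ** Y = c *\<^sub>M (X ** Y)"
  by (simp add: mscale_def map_matrix_def matrix_matrix_mult_def vec_eq_iff sum_distrib_left
      mult.assoc)

lemma mstar_mat_1: "mstar (mat 1) = mat 1"
  by (simp add: mstar_def map_matrix_def transpose_def mat_def vec_eq_iff)

lemma Psi_0:
  assumes "\<Phi> (\<gamma> 0) p \<in> SL2"
  shows "Psi \<Phi> \<gamma> 0 p = mat 1"
proof -
  have "invertible (\<Phi> (\<gamma> 0) p)"
    using assms by (simp add: SL2_def invertible_det_nz)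
  then have "\<Phi> (\<gamma> 0) p ** matrix_inv (\<Phi> (\<gamma> 0) p) = mat 1"
    unfolding invertible_def matrix_inv_def by (rule someI_ex[THEN conjunct1])
  then show ?thesis
    by (simp add: Psi_def)
qed

lemma has_vector_derivative_Psi:
  assumes "(\<lambda>l. \<Phi> l p) mholomorphic_on UNIV" and "(\<gamma> has_vector_derivative l1 - \<gamma> 0) (at 0)"
  shows "((\<lambda>t. Psi \<Phi> \<gamma> t p) has_vector_derivative minimal_psi \<Phi> (\<gamma> 0) l1 p) (at 0)"
  using has_vector_derivative_matrix_mult
    [OF has_vector_derivative_mholomorphic_compose[OF assms(1) open_UNIV UNIV_I assms(2)]
      has_vector_derivative_const[of "matrix_inv (\<Phi> (\<gamma> 0) p)"]]
  by (simp add: Psi_def minimal_psi_def mscale_matrix_mult)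

theorem proposition4p7:
  fixes M :: "'a topology" and \<A> :: "'a chart set"
    and \<Phi> :: "complex \<Rightarrow> 'a \<Rightarrow> mat2"
    and l0 l1 :: complex and \<epsilon> :: real and \<gamma> :: "real \<Rightarrow> complex"
  assumes "riemann_surface M \<A>"
    and "l0 \<noteq> l1"
    and "\<epsilon> > 0"
    and "\<gamma> differentiable_on {-\<epsilon><..<\<epsilon>}"
    and "\<gamma> 0 = l0"
    and "vector_derivative \<gamma> (at 0) = l1 - l0"
    and "LWR_frame M \<A> \<Phi>"
  shows "\<forall>p\<in>topspace M.
           ((\<lambda>t. f_H \<Phi> \<gamma> t p) has_vector_derivative minimal_immersion \<Phi> l0 l1 p) (at 0)"
proof
  fix p assume p: "p \<in> topspace M"
  have "\<gamma> differentiable (at 0)"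
    using assms(3,4) by (simp add: differentiable_on_eq_differentiable_at)
  then have \<gamma>': "(\<gamma> has_vector_derivative l1 - \<gamma> 0) (at 0)"
    using assms(5,6) by (simp add: vector_derivative_works)
  have holo: "(\<lambda>l. \<Phi> l p) mholomorphic_on UNIV" and SL2: "\<Phi> (\<gamma> 0) p \<in> SL2"
    using assms(7) p by (auto simp: LWR_frame_def)
  note Psi' = has_vector_derivative_Psi[of \<Phi> p, OF holo \<gamma>']
  from has_vector_derivative_matrix_mult[OF has_vector_derivative_mstar[OF Psi'] Psi']
  show "((\<lambda>t. f_H \<Phi> \<gamma> t p) has_vector_derivative minimal_immersion \<Phi> l0 l1 p) (at 0)"
    by (simp add: f_H_def minimal_immersion_def Psi_0[of \<Phi> \<gamma>, OF SL2] mstar_mat_1 assms(5))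
qed

end
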